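(* Let $d$ be a positive integer and let $G$ be a $d$-dimensional rectangular grid with maximum degree $2d$. Then $s(G)=2d$.
   Context: A vertex labeling of a graph $G$ is an injective map $f:V(G)\to\mathbb{Z}$. It induces the edge labeling $f^+:E(G)\to\mathbb{Z}$, $f^+(uv)=f(u)+f(v)$, and $|f^+|$ denotes the number of distinct values $f^+$ takes on $E(G)$. The sum index $s(G)$ is the minimum positive integer $k$ such that there exists a vertex labeling $f$ of $G$ with $|f^+|=k$. A $d$-dimensional rectangular grid is a graph determined by positive integers $n_1,\dotsc,n_d$, with one vertex for each integer vector $(i_1,i_2,\dotsc,i_d)$ with $0\leq i_t\leq n_t-1$ for all $1\leq t\leq d$, where two vertices are adjacent if and only if their vectors differ in exactly one coordinate, and in that coordinate they differ by exactly $1$. (The maximum degree equals $2d$ exactly when $n_t\geq3$ for all $t$.) *)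

theory Defs
  imports "Graph_Theory.Pair_Digraph"
begin

text \<open>
  A finite simple graph is a \<^locale>\<open>pair_graph\<close>: a finite loop-free digraph whose arcs form
  a symmetric relation. An edge uv is thus represented by the two arcs (u, v) and (v, u).
\<close>

text \<open>In a symmetric digraph, the out-degree of a vertex is its degree as a graph vertex.\<close>

definition max_degree :: "'a pair_pre_digraph \<Rightarrow> nat" where
  "max_degree G = Max ((\<lambda>v. out_degree (with_proj G) v) ` pverts G)"

definition vertex_labeling :: "'a pair_pre_digraph \<Rightarrow> ('a \<Rightarrow> int) \<Rightarrow> bool" where
  "vertex_labeling G f \<longleftrightarrow> inj_on f (pverts G)"

text \<open>
  The two arcs of an edge get the same label, so the induced labeling is well defined
  on edges and has the same set of values on edges as on arcs.
\<close>

definition edge_labeling :: "('a \<Rightarrow> int) \<Rightarrow> 'a \<times> 'a \<Rightarrow> int" where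
  "edge_labeling f e = f (fst e) + f (snd e)"

definition num_edge_labels :: "'a pair_pre_digraph \<Rightarrow> ('a \<Rightarrow> int) \<Rightarrow> nat" where
  "num_edge_labels G f = card (edge_labeling f ` parcs G)"

text \<open>For an edgeless graph no positive k qualifies, and the value is unspecified.\<close>

definition sum_index :: "'a pair_pre_digraph \<Rightarrow> nat" where
  "sum_index G = (LEAST k. 0 < k \<and> (\<exists>f. vertex_labeling G f \<and> num_edge_labels G f = k))"

text \<open>Coordinates are counted from 0, so \<open>ns ! t\<close> is the side length $n_{t+1}$.\<close>

definition grid_vectors :: "nat list \<Rightarrow> int list set" where
  "grid_vectors ns =
    {x. length x = length ns \<and> (\<forall>t<length ns. 0 \<le> x ! t \<and> x ! t \<le> int (ns ! t) - 1)}"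

definition grid_adjacent :: "int list \<Rightarrow> int list \<Rightarrow> bool" where
  "grid_adjacent x y \<longleftrightarrow> length x = length y \<and>
    (\<exists>t<length x. \<bar>x ! t - y ! t\<bar> = 1 \<and> (\<forall>s<length x. s \<noteq> t \<longrightarrow> x ! s = y ! s))"

text \<open>
  The vertices may be of any type; \<open>\<phi>\<close> is the one-to-one correspondence between vertices
  and integer vectors.
\<close>

definition rectangular_grid :: "nat \<Rightarrow> 'a pair_pre_digraph \<Rightarrow> bool" where
  "rectangular_grid d G \<longleftrightarrow> pair_graph G \<and>
    (\<exists>ns \<phi>. length ns = d \<and> (\<forall>n\<in>set ns. 0 < n) \<and>
      bij_betw \<phi> (pverts G) (grid_vectors ns) \<and>
      (\<forall>u\<in>pverts G. \<forall>v\<in>pverts G. (u, v) \<in> parcs G \<longleftrightarrow> grid_adjacent (\<phi> u) (\<phi> v)))"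

end

theory Submission
  imports Defs
begin

text \<open>
  Lower bound: the edges at a vertex of maximum degree have pairwise distinct labels, because
  the labels of their other endpoints are distinct; hence every labeling uses at least \<open>2 * d\<close>
  edge labels.

  Upper bound: read the coordinates of a grid point \<open>x\<close> as the digits of a number \<open>g x\<close> in a
  base \<open>b\<close> at least as large as every side length, and let the sign alternate along edges:
  \<open>f x = g x\<close> or \<open>f x = - g x\<close> according to the parity of the coordinate sum. Along an edge in
  direction \<open>t\<close> the parity changes and \<open>g\<close> changes by \<open>b ^ t\<close>, so the sum of the two labels is
  a difference of two values of \<open>g\<close> and equals \<open>b ^ t\<close> or \<open>- (b ^ t)\<close>: at most two edge
  labels for each of the \<open>d\<close> directions. The labeling is injective because digit expansions
  are unique and \<open>g\<close> is nonnegative, so that labels of opposite sign can agree only at the origin.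
\<close>

lemma max_degree_le_num_edge_labels:
  assumes "pair_graph G" and "pverts G \<noteq> {}" and "vertex_labeling G f"
  shows "max_degree G \<le> num_edge_labels G f"
proof -
  interpret pair_graph G by fact
  have "out_degree (with_proj G) v \<le> num_edge_labels G f" for v
  proof -
    have fin: "finite (parcs G)" by (rule pair_finite_arcs)
    have "inj_on (edge_labeling f) (out_arcs (with_proj G) v)"
    proof (rule inj_onI)
      fix e e'
      assume e: "e \<in> out_arcs (with_proj G) v" and e': "e' \<in> out_arcs (with_proj G) v"
        and "edge_labeling f e = edge_labeling f e'"
      then have "f (snd e) = f (snd e')" and "fst e = fst e'"
        by (auto simp: edge_labeling_def out_arcs_def)
      moreover have "snd e \<in> pverts G" "snd e' \<in> pverts G"
        using e e' by (auto simp: out_arcs_def intro: in_arcsD2)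
      ultimately show "e = e'"
        using \<open>vertex_labeling G f\<close> by (auto simp: vertex_labeling_def prod_eq_iff dest: inj_onD)
    qed
    then have "out_degree (with_proj G) v = card (edge_labeling f ` out_arcs (with_proj G) v)"
      by (simp add: out_degree_def card_image)
    also have "\<dots> \<le> num_edge_labels G f"
      unfolding num_edge_labels_def using fin by (intro card_mono) (auto simp: out_arcs_def)
    finally show ?thesis .
  qed
  then show ?thesis
    using \<open>pverts G \<noteq> {}\<close> by (simp add: max_degree_def)
qed

lemma horner_sum_list_update:
  fixes b :: "'a::comm_ring_1"
  assumes "t < length xs"
  shows "horner_sum id b (xs[t := a]) = horner_sum id b xs + (a - xs ! t) * b ^ t"
  using assms
proof (induction xs arbitrary: t)
  case (Cons x xs)
  then show ?case by (cases t) (auto simp: distrib_left mult.left_commute)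
qed simp

text \<open>In this form, the effect of changing one entry is a case of the preceding lemma.\<close>

lemma sum_list_eq_horner_sum:
  fixes xs :: "'a::comm_ring_1 list"
  shows "sum_list xs = horner_sum id 1 xs"
  by (induction xs) auto

lemma horner_sum_nonneg:
  fixes b :: "'a::linordered_idom"
  assumes "0 \<le> b" and "\<forall>x\<in>set xs. 0 \<le> x"
  shows "0 \<le> horner_sum id b xs"
  using assms by (induction xs) auto

text \<open>The first digit is the remainder modulo the base, so digit expansions are unique.\<close>

lemma horner_sum_digits_inject:
  fixes b :: int
  assumes "length xs = length ys"
    and "\<forall>x\<in>set xs. 0 \<le> x \<and> x < b" and "\<forall>y\<in>set ys. 0 \<le> y \<and> y < b"
    and "horner_sum id b xs = horner_sum id b ys"
  shows "xs = ys"
  using assms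
proof (induction xs ys rule: list_induct2)
  case (Cons x xs y ys)
  have "(x + b * horner_sum id b xs) mod b = (y + b * horner_sum id b ys) mod b"
    using arg_cong[OF Cons.prems(3), of "\<lambda>n. n mod b"] by simp
  then have "x mod b = y mod b"
    by (simp only: mod_mult_self2)
  then have "x = y"
    using Cons.prems(1,2) by simp
  with Cons show ?case by auto
qed simp

definition alternating_label :: "int \<Rightarrow> int list \<Rightarrow> int" where
  "alternating_label b x =
    (if even (sum_list x) then horner_sum id b x else - horner_sum id b x)"

lemma inj_on_alternating_label:
  assumes "\<forall>x\<in>S. length x = d \<and> (\<forall>i\<in>set x. 0 \<le> i \<and> i < b)"
  shows "inj_on (alternating_label b) S"
proof (rule inj_onI)
  fix x y
  assume S: "x \<in> S" "y \<in> S" and eq: "alternating_label b x = alternating_label b y"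
  have digits: "length x = length y" "\<forall>i\<in>set x. 0 \<le> i \<and> i < b" "\<forall>i\<in>set y. 0 \<le> i \<and> i < b"
    using assms S by auto
  have nonneg: "0 \<le> horner_sum id b z" if "\<forall>i\<in>set z. 0 \<le> i \<and> i < b" for z
  proof (cases z)
    case (Cons a z')
    with that have "0 \<le> b" by auto
    with that show ?thesis by (intro horner_sum_nonneg) auto
  qed simp
  \<comment> \<open>If the signs differ, then both nonnegative values vanish.\<close>
  have "horner_sum id b x = horner_sum id b y"
    using eq nonneg[OF digits(2)] nonneg[OF digits(3)]
    by (simp add: alternating_label_def split: if_splits)
  with digits show "x = y"
    by (intro horner_sum_digits_inject) auto
qed

text \<open>
  The two endpoints of an edge have opposite signs, so their labels add up to a difference of
  two digit expansions that agree except in one digit.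
\<close>

lemma alternating_label_adjacent:
  assumes "grid_adjacent x y"
  shows "alternating_label b x + alternating_label b y
    \<in> (\<lambda>t. b ^ t) ` {..<length x} \<union> (\<lambda>t. - (b ^ t)) ` {..<length x}"
proof -
  obtain t where t: "t < length x" "\<bar>x ! t - y ! t\<bar> = 1"
    and len: "length x = length y" and eq: "\<forall>s<length x. s \<noteq> t \<longrightarrow> x ! s = y ! s"
    using assms by (auto simp: grid_adjacent_def)
  define a where "a = y ! t"
  have y: "y = x[t := a]"
    using t(1) len eq by (auto intro!: nth_equalityI simp: a_def nth_list_update)
  have "sum_list y = sum_list x + (a - x ! t)"
    unfolding y sum_list_eq_horner_sum by (simp only: horner_sum_list_update[OF t(1)]) simp
  moreover have "horner_sum id b y = horner_sum id b x + (a - x ! t) * b ^ t"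
    unfolding y by (rule horner_sum_list_update[OF t(1)])
  moreover have "a = x ! t + 1 \<or> a = x ! t - 1"
    using t(2) unfolding a_def by linarith
  ultimately have "alternating_label b x + alternating_label b y \<in> {b ^ t, - (b ^ t)}"
    by (auto simp: alternating_label_def)
  with t(1) show ?thesis by auto
qed

lemma rectangular_grid_labeling:
  assumes "rectangular_grid d G"
  obtains f where "vertex_labeling G f" and "num_edge_labels G f \<le> 2 * d"
proof -
  from assms obtain ns \<phi> where G: "pair_graph G" and ns: "length ns = d"
    and bij: "bij_betw \<phi> (pverts G) (grid_vectors ns)"
    and adj: "\<forall>u\<in>pverts G. \<forall>v\<in>pverts G. (u, v) \<in> parcs G \<longleftrightarrow> grid_adjacent (\<phi> u) (\<phi> v)"
    by (auto simp: rectangular_grid_def)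
  interpret pair_graph G by (fact G)
  \<comment> \<open>The sum of the side lengths is a convenient common upper bound for them.\<close>
  define b where "b = int (sum_list ns)"
  have digits: "length x = d \<and> (\<forall>i\<in>set x. 0 \<le> i \<and> i < b)" if x: "x \<in> grid_vectors ns" for x
  proof -
    have len: "length x = length ns"
      using x by (simp add: grid_vectors_def)
    have "0 \<le> x ! t \<and> x ! t < b" if "t < length ns" for t
    proof -
      have "ns ! t \<le> sum_list ns"
        using that by (intro member_le_sum_list) auto
      moreover have "0 \<le> x ! t" and "x ! t \<le> int (ns ! t) - 1"
        using x that by (auto simp: grid_vectors_def)
      ultimately show ?thesis
        by (simp add: b_def)
    qed
    with len ns show ?thesis
      by (simp add: all_set_conv_all_nth)
  qed
  let ?f = "alternating_label b \<circ> \<phi>"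
  let ?L = "(\<lambda>t. b ^ t) ` {..<d} \<union> (\<lambda>t. - (b ^ t)) ` {..<d}"
  have "vertex_labeling G ?f"
    unfolding vertex_labeling_def
    using bij digits inj_on_alternating_label[of "grid_vectors ns" d b]
    by (auto simp: bij_betw_def intro: comp_inj_on)
  moreover have "edge_labeling ?f ` parcs G \<subseteq> ?L"
  proof
    fix l assume "l \<in> edge_labeling ?f ` parcs G"
    then obtain u v where uv: "(u, v) \<in> parcs G" and l: "l = ?f u + ?f v"
      by (auto simp: edge_labeling_def)
    have "u \<in> pverts G" "v \<in> pverts G"
      using uv by (auto dest: in_arcsD1 in_arcsD2)
    then have "grid_adjacent (\<phi> u) (\<phi> v)" and "\<phi> u \<in> grid_vectors ns"
      using uv adj bij by (auto simp: bij_betw_def)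
    with alternating_label_adjacent[of "\<phi> u" "\<phi> v" b] digits[of "\<phi> u"] l show "l \<in> ?L"
      by simp
  qed
  then have "num_edge_labels G ?f \<le> card ?L"
    unfolding num_edge_labels_def by (intro card_mono) auto
  moreover have "card ?L \<le> d + d"
    using card_Un_le[of "(\<lambda>t. b ^ t) ` {..<d}" "(\<lambda>t. - (b ^ t)) ` {..<d}"]
      card_image_le[of "{..<d}" "\<lambda>t. b ^ t"] card_image_le[of "{..<d}" "\<lambda>t. - (b ^ t)"]
    by simp
  ultimately show thesis
    by (intro that[of ?f]) auto
qed

lemma rectangular_grid_nonempty:
  assumes "rectangular_grid d G"
  shows "pverts G \<noteq> {}"
proof -
  from assms obtain ns \<phi> where "\<forall>n\<in>set ns. 0 < n" and "bij_betw \<phi> (pverts G) (grid_vectors ns)"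
    by (auto simp: rectangular_grid_def)
  moreover from this have "replicate (length ns) 0 \<in> grid_vectors ns"
    by (auto simp: grid_vectors_def Suc_le_eq)
  ultimately show ?thesis
    by (auto simp: bij_betw_def)
qed

theorem corollary2p14:
  fixes d :: nat and G :: "'a pair_pre_digraph"
  assumes "0 < d"
    and "rectangular_grid d G"
    and "max_degree G = 2 * d"
  shows "sum_index G = 2 * d"
proof -
  have lower: "2 * d \<le> num_edge_labels G f" if "vertex_labeling G f" for f
    using max_degree_le_num_edge_labels[of G f] rectangular_grid_nonempty[of d G] assms that
    by (auto simp: rectangular_grid_def)
  obtain f where "vertex_labeling G f" and "num_edge_labels G f \<le> 2 * d"
    using rectangular_grid_labeling[OF assms(2)] .
  with lower[of f] have "vertex_labeling G f" and "num_edge_labels G f = 2 * d"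
    by auto
  with \<open>0 < d\<close> lower show ?thesis
    unfolding sum_index_def by (intro Least_equality) auto
qed

end
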